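(* Consider a causal model over a finite set $S$ of observed random variables and let $X,Y,Z,W\subseteq S$ be pairwise disjoint with $X,Y$ non-empty. Then: 1. If $X\models Y\mid\mathrm{do}(Z)$ is indecreasable, then each $e_Z\in Z$ is a cause of at least one element $e_Y\in Y$. 2. If $X\models Y\mid\{\mathrm{do}(Z),W\}$ is indecreasable, then each $e_Z\in Z$ is a cause of at least one element $e_{YW}\in Y\cup W$.
   Context: Causal structure. A causal structure is a directed graph $\mathcal G$ whose nodes are either observed or unobserved; the observed nodes form a finite set $S$ of (discrete) random variables, while unobserved nodes may be arbitrary systems (classical, quantum, or of a generalized probabilistic theory). $\mathcal G$ may be cyclic. A node $N$ is a cause of a node $M$ if there is a directed path (with at least one edge) from $N$ to $M$. For disjoint node sets, $X$ and $Y$ are d-separated by $Z$ if every undirected path between an element of $X$ and an element of $Y$ is blocked by $Z$, i.e. contains a segment $A\to V\to B$ or $A\leftarrow V\to B$ with $V\in Z$, or a collider $A\to V\leftarrow B$ such that neither $V$ nor any descendant of $V$ is in $Z$. A distribution over the observed nodes is compatible with the graph if d-separation of disjoint observed sets $X,Y$ by observed $Z$ implies the conditional independence $P(XY|Z)=P(X|Z)P(Y|Z)$. Causal model and interventions. A causal model over $S$ is such a graph $\mathcal G$ with a compatible distribution $P_{\mathcal G}$ over $S$, together with intervention data: for $X\subseteq S$, the augmented graph $\mathcal G_{I_X}$ adds for each $e\in X$ a parentless observed node $I_e$ with an edge $I_e\to e$ (values: "idle", or $\mathrm{do}(x)$ for values $x$ of $e$), and $\mathcal G_{\mathrm{do}(X)}$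 is obtained from $\mathcal G_{I_X}$ by deleting all edges into $X$ other than those from $I_X$. Both carry compatible distributions with $P_{\mathcal G_{I_X}}(\cdot|I_X=\text{idle})=P_{\mathcal G}(\cdot)$, $P_{\mathcal G_{I_X}}(\cdot|I_X=\mathrm{do}(x))=P_{\mathcal G_{\mathrm{do}(X)}}(\cdot|I_X=\mathrm{do}(x))=P_{\mathcal G_{\mathrm{do}(X)}}(\cdot|X=x)$, and $I_X=\mathrm{do}(x)$ forces $X=x$. The same construction is applied to post-intervention models $\mathcal G_{\mathrm{do}(Z)}$ (intervening on $X$ there gives $\mathcal G_{\mathrm{do}(X\cup Z)}$). All conditional distributions that appear are assumed well-defined. Affects relations. For pairwise disjoint $X,Y,Z,W\subseteq S$ with $X,Y$ non-empty, $X\models Y\mid\{\mathrm{do}(Z),W\}$ holds if there exist values $x,z,w$ with $$P_{\mathcal G_{\mathrm{do}(X\cup Z)}}(Y| X=x,Z=z,W=w)\neq P_{\mathcal G_{\mathrm{do}(Z)}}(Y| Z=z,W=w);$$ otherwise $X\not\models Y\mid\{\mathrm{do}(Z),W\}$. When $W=\emptyset$ one writes $X\models Y\mid\mathrm{do}(Z)$. The relation $X\models Y\mid\{\mathrm{do}(Z),W\}$ is indecreasable if it holds but $X\not\models Y\mid\{\mathrm{do}(Z\setminus\{e_Z\}),W\}$ for all $e_Z\in Z$. *)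

theory Defs
  imports "HOL-Probability.Probability"
begin

section \<open>Causal structures and d-separation\<close>

text \<open>Cycles and self-loops are allowed. Unobserved nodes carry no data: the nature of the
  corresponding systems enters only through compatibility of the observed distribution.\<close>

record 'n causal_structure =
  nodes :: "'n set"
  observed :: "'n set"
  edges :: "'n rel"

definition wf_structure :: "'n causal_structure \<Rightarrow> bool" where
  "wf_structure G \<longleftrightarrow>
     finite (observed G) \<and> observed G \<subseteq> nodes G \<and> edges G \<subseteq> nodes G \<times> nodes G"

definition is_cause :: "'n causal_structure \<Rightarrow> 'n \<Rightarrow> 'n \<Rightarrow> bool" where
  "is_cause G a b \<longleftrightarrow> (a, b) \<in> (edges G)\<^sup>+"

text \<open>An undirected path consists of its nodes \<open>vs\<close> and the orientations \<open>ds\<close> of its edges: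
  \<open>ds ! i\<close> says that the path uses the edge \<open>vs ! i \<rightarrow> vs ! Suc i\<close>, its negation that it uses the
  edge \<open>vs ! i \<leftarrow> vs ! Suc i\<close>. The orientations are part of the path because a cyclic graph may
  contain both edges between two nodes.\<close>

definition undirected_path :: "'n causal_structure \<Rightarrow> 'n list \<Rightarrow> bool list \<Rightarrow> bool" where
  "undirected_path G vs ds \<longleftrightarrow>
     length vs = Suc (length ds) \<and> distinct vs \<and>
     (\<forall>i < length ds. if ds ! i then (vs ! i, vs ! Suc i) \<in> edges G
                                else (vs ! Suc i, vs ! i) \<in> edges G)"

definition blocked :: "'n causal_structure \<Rightarrow> 'n set \<Rightarrow> 'n list \<Rightarrow> bool list \<Rightarrow> bool" where
  "blocked G Z vs ds \<longleftrightarrow>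
     (\<exists>i. Suc i < length ds \<and>
        (if ds ! i \<and> \<not> ds ! Suc i
         then vs ! Suc i \<notin> Z \<and> (\<forall>d. is_cause G (vs ! Suc i) d \<longrightarrow> d \<notin> Z)
         else vs ! Suc i \<in> Z))"

definition d_separated :: "'n causal_structure \<Rightarrow> 'n set \<Rightarrow> 'n set \<Rightarrow> 'n set \<Rightarrow> bool" where
  "d_separated G X Y Z \<longleftrightarrow>
     (\<forall>vs ds. undirected_path G vs ds \<and> hd vs \<in> X \<and> last vs \<in> Y \<longrightarrow> blocked G Z vs ds)"


section \<open>Compatible distributions\<close>

definition event :: "'n set \<Rightarrow> ('n \<Rightarrow> 'o) \<Rightarrow> ('n \<Rightarrow> 'o) set" where
  "event A v = {\<omega>. \<forall>a\<in>A. \<omega> a = v a}"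

definition marginal :: "'n set \<Rightarrow> ('n \<Rightarrow> 'o) pmf \<Rightarrow> ('n \<Rightarrow> 'o) pmf" where
  "marginal A P = map_pmf (\<lambda>\<omega>. restrict \<omega> A) P"

text \<open>For disjoint sets, a single assignment \<open>v\<close> supplies the values of all of \<open>X\<close>, \<open>Y\<close>, \<open>Z\<close>.
  The side condition makes the conditional distribution well-defined.\<close>

definition cond_indep :: "('n \<Rightarrow> 'o) pmf \<Rightarrow> 'n set \<Rightarrow> 'n set \<Rightarrow> 'n set \<Rightarrow> bool" where
  "cond_indep P X Y Z \<longleftrightarrow>
     (\<forall>v. measure_pmf.prob P (event Z v) > 0 \<longrightarrow>
        measure_pmf.prob (cond_pmf P (event Z v)) (event X v \<inter> event Y v) =
        measure_pmf.prob (cond_pmf P (event Z v)) (event X v) *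
        measure_pmf.prob (cond_pmf P (event Z v)) (event Y v))"

definition compatible :: "'n causal_structure \<Rightarrow> ('n \<Rightarrow> 'o) pmf \<Rightarrow> bool" where
  "compatible G P \<longleftrightarrow>
     (\<forall>X Y Z. X \<subseteq> observed G \<and> Y \<subseteq> observed G \<and> Z \<subseteq> observed G \<and>
        X \<inter> Y = {} \<and> X \<inter> Z = {} \<and> Y \<inter> Z = {} \<and> d_separated G X Y Z \<longrightarrow>
        cond_indep P X Y Z)"


section \<open>Interventions\<close>

text \<open>\<open>Sys e\<close> is the node \<open>e\<close> of the original structure and \<open>Intv e\<close> is the node \<open>I_e\<close>.\<close>

datatype 'v node = Sys 'v | Intv 'v

datatype 'a outcome = Val 'a | Idle | Do 'a

definition embed :: "'v causal_structure \<Rightarrow> 'v node causal_structure" where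
  "embed G = \<lparr>nodes = Sys ` nodes G, observed = Sys ` observed G,
              edges = map_prod Sys Sys ` edges G\<rparr>"

definition augment :: "'v set \<Rightarrow> 'v node causal_structure \<Rightarrow> 'v node causal_structure" where
  "augment X G = \<lparr>nodes = nodes G \<union> Intv ` X, observed = observed G \<union> Intv ` X,
                  edges = edges G \<union> {(Intv e, Sys e) | e. e \<in> X}\<rparr>"

definition do_graph :: "'v set \<Rightarrow> 'v node causal_structure \<Rightarrow> 'v node causal_structure" where
  "do_graph X G = (augment X G)
     \<lparr>edges := {(a, b) \<in> edges (augment X G). b \<in> Sys ` X \<longrightarrow> a \<in> Intv ` X}\<rparr>"

lemma do_graph_empty: "do_graph {} G = G"
  by (simp add: do_graph_def augment_def)

lemma do_graph_do_graph:
  assumes "X \<inter> Z = {}"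
  shows "do_graph X (do_graph Z (embed G)) = do_graph (X \<union> Z) (embed G)"
  using assms by (auto simp: do_graph_def augment_def embed_def)

text \<open>\<open>P_do M Z\<close> is the distribution for \<open>G_do(Z)\<close>, and \<open>P_aug M Z X\<close> the one for
  \<open>(G_do(Z))_I_X\<close>, the augmented graph for an intervention on \<open>X\<close> in the post-intervention model
  of \<open>Z\<close>. Since \<open>G_do({}) = G\<close>, the distribution over \<open>S\<close> of the model itself is \<open>P_do M {}\<close>,
  and \<open>P_aug M {} X\<close> is the distribution for \<open>G_I_X\<close>.\<close>

record ('v, 'a) model =
  graph :: "'v causal_structure"
  vals :: "'v \<Rightarrow> 'a set"
  P_do :: "'v set \<Rightarrow> ('v node \<Rightarrow> 'a outcome) pmf"
  P_aug :: "'v set \<Rightarrow> 'v set \<Rightarrow> ('v node \<Rightarrow> 'a outcome) pmf"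

abbreviation variables :: "('v, 'a) model \<Rightarrow> 'v set" where
  "variables M \<equiv> observed (graph M)"

fun outcomes :: "('v \<Rightarrow> 'a set) \<Rightarrow> 'v node \<Rightarrow> 'a outcome set" where
  "outcomes V (Sys e) = Val ` V e"
| "outcomes V (Intv e) = insert Idle (Do ` V e)"

definition distribution_for ::
  "('v \<Rightarrow> 'a set) \<Rightarrow> 'v node causal_structure \<Rightarrow> ('v node \<Rightarrow> 'a outcome) pmf \<Rightarrow> bool" where
  "distribution_for V G P \<longleftrightarrow>
     set_pmf P \<subseteq> (\<Pi>\<^sub>E n \<in> observed G. outcomes V n) \<and> compatible G P"

definition idle_event :: "'v set \<Rightarrow> ('v node \<Rightarrow> 'a outcome) set" where
  "idle_event X = {\<omega>. \<forall>e\<in>X. \<omega> (Intv e) = Idle}"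

definition do_event :: "'v set \<Rightarrow> ('v \<Rightarrow> 'a) \<Rightarrow> ('v node \<Rightarrow> 'a outcome) set" where
  "do_event X x = {\<omega>. \<forall>e\<in>X. \<omega> (Intv e) = Do (x e)}"

definition val_event :: "'v set \<Rightarrow> ('v \<Rightarrow> 'a) \<Rightarrow> ('v node \<Rightarrow> 'a outcome) set" where
  "val_event X x = {\<omega>. \<forall>e\<in>X. \<omega> (Sys e) = Val (x e)}"

text \<open>The positivity requirements express that the conditional distributions are
  well-defined; \<open>cond_pmf\<close> is meaningful only for events of positive probability. The
  distributions are compared as distributions over the original variables.\<close>

definition intervention_rules :: "('v, 'a) model \<Rightarrow> 'v set \<Rightarrow> 'v set \<Rightarrow> bool" where
  "intervention_rules M Z X \<longleftrightarrow>
     measure_pmf.prob (P_aug M Z X) (idle_event X) > 0 \<and>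
     marginal (Sys ` variables M) (cond_pmf (P_aug M Z X) (idle_event X)) =
       marginal (Sys ` variables M) (P_do M Z) \<and>
     (\<forall>x. (\<forall>e\<in>X. x e \<in> vals M e) \<longrightarrow>
        measure_pmf.prob (P_aug M Z X) (do_event X x) > 0 \<and>
        measure_pmf.prob (P_do M (X \<union> Z)) (do_event X x) > 0 \<and>
        measure_pmf.prob (P_do M (X \<union> Z)) (val_event X x) > 0 \<and>
        marginal (Sys ` variables M) (cond_pmf (P_aug M Z X) (do_event X x)) =
          marginal (Sys ` variables M) (cond_pmf (P_do M (X \<union> Z)) (do_event X x)) \<and>
        marginal (Sys ` variables M) (cond_pmf (P_do M (X \<union> Z)) (do_event X x)) =
          marginal (Sys ` variables M) (cond_pmf (P_do M (X \<union> Z)) (val_event X x)) \<and>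
        set_pmf (P_aug M Z X) \<inter> do_event X x \<subseteq> val_event X x \<and>
        set_pmf (P_do M (X \<union> Z)) \<inter> do_event X x \<subseteq> val_event X x)"

definition causal_model :: "('v, 'a) model \<Rightarrow> bool" where
  "causal_model M \<longleftrightarrow>
     wf_structure (graph M) \<and>
     (\<forall>Z \<subseteq> variables M.
        distribution_for (vals M) (do_graph Z (embed (graph M))) (P_do M Z)) \<and>
     (\<forall>Z X. Z \<subseteq> variables M \<and> X \<subseteq> variables M \<and> X \<inter> Z = {} \<longrightarrow>
        distribution_for (vals M) (augment X (do_graph Z (embed (graph M)))) (P_aug M Z X) \<and>
        intervention_rules M Z X)"


section \<open>Affects relations\<close>

text \<open>\<open>affects M X Y Z W\<close> is \<open>X \<Turnstile> Y | {do(Z), W}\<close>. The sets being disjoint, a single assignment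
  \<open>s\<close> supplies the values \<open>x\<close>, \<open>z\<close>, \<open>w\<close>, which range over those for which both conditional
  distributions are well-defined.\<close>

definition affects :: "('v, 'a) model \<Rightarrow> 'v set \<Rightarrow> 'v set \<Rightarrow> 'v set \<Rightarrow> 'v set \<Rightarrow> bool" where
  "affects M X Y Z W \<longleftrightarrow>
     (\<exists>s. (\<forall>e \<in> X \<union> Z \<union> W. s e \<in> vals M e) \<and>
        measure_pmf.prob (P_do M (X \<union> Z)) (val_event (X \<union> Z \<union> W) s) > 0 \<and>
        measure_pmf.prob (P_do M Z) (val_event (Z \<union> W) s) > 0 \<and>
        marginal (Sys ` Y) (cond_pmf (P_do M (X \<union> Z)) (val_event (X \<union> Z \<union> W) s)) \<noteq>
        marginal (Sys ` Y) (cond_pmf (P_do M Z) (val_event (Z \<union> W) s)))"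

definition indecreasable :: "('v, 'a) model \<Rightarrow> 'v set \<Rightarrow> 'v set \<Rightarrow> 'v set \<Rightarrow> 'v set \<Rightarrow> bool" where
  "indecreasable M X Y Z W \<longleftrightarrow>
     affects M X Y Z W \<and> (\<forall>e\<in>Z. \<not> affects M X Y (Z - {e}) W)"

end

theory Submission
  imports Defs
begin

text \<open>Suppose \<open>e \<in> Z\<close> causes nothing in \<open>Y \<union> W\<close>, and let \<open>R\<close> be \<open>Z - {e}\<close> or \<open>X \<union> (Z - {e})\<close>.
  In \<open>G_do(R)\<close> the nodes of \<open>R\<close> have no parents but their intervention nodes, so they are no
  descendants of \<open>e\<close> either. In the structure augmented by \<open>I_e\<close>, every path from \<open>I_e\<close> to
  \<open>R \<union> W \<union> Y\<close> therefore contains a collider, and \<open>I_e\<close> is independent of \<open>R \<union> W \<union> Y\<close> without any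
  conditioning. Comparing \<open>I_e = idle\<close> with \<open>I_e = do(s e)\<close> shows that \<open>P_do(R)\<close> and
  \<open>P_do(R \<union> {e})\<close>, given \<open>e = s e\<close>, have the same joint distribution on \<open>R \<union> W \<union> Y\<close>. Hence \<open>e\<close> can
  be dropped from both sides of the affects relation without changing them, contradicting
  indecreasability.\<close>

lemma event_empty [simp]: "event {} v = UNIV"
  by (simp add: event_def)

text \<open>Unconditional independence is \<open>cond_indep\<close> with an empty last set, where
  the conditioning event is \<open>UNIV\<close>.\<close>

lemma cond_pmf_UNIV: "cond_pmf p UNIV = p"
proof (rule pmf_eqI)
  fix x
  have "set_pmf p \<inter> UNIV \<noteq> {}" by (simp add: set_pmf_not_empty)
  then show "pmf (cond_pmf p UNIV) x = pmf p x"
    by (simp add: pmf_cond)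
qed

lemma prob_cond_pmf:
  assumes "set_pmf p \<inter> A \<noteq> {}"
  shows "measure_pmf.prob (cond_pmf p A) B = measure_pmf.prob p (A \<inter> B) / measure_pmf.prob p A"
  using assms
  by (simp add: cond_pmf.rep_eq measure_uniform_measure emeasure_measure_pmf_not_zero)

lemma cond_pmf_cond_pmf:
  assumes "set_pmf p \<inter> (A \<inter> B) \<noteq> {}"
  shows "cond_pmf (cond_pmf p A) B = cond_pmf p (A \<inter> B)"
proof (rule pmf_eqI)
  fix x
  have A: "set_pmf p \<inter> A \<noteq> {}" using assms by auto
  have B: "set_pmf (cond_pmf p A) \<inter> B \<noteq> {}"
    using assms by (auto simp: set_cond_pmf[OF A])
  have "measure_pmf.prob p A \<noteq> 0"
    using A by (simp add: measure_pmf_zero_iff)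
  moreover have "measure_pmf.prob (cond_pmf p A) B =
      measure_pmf.prob p (A \<inter> B) / measure_pmf.prob p A"
    by (rule prob_cond_pmf[OF A])
  ultimately show "pmf (cond_pmf (cond_pmf p A) B) x = pmf (cond_pmf p (A \<inter> B)) x"
    by (simp add: pmf_cond[OF A] pmf_cond[OF B] pmf_cond[OF assms])
qed

lemma prob_pos_iff: "measure_pmf.prob p A > 0 \<longleftrightarrow> set_pmf p \<inter> A \<noteq> {}"
  by (simp add: zero_less_measure_iff measure_pmf_zero_iff)

lemma marginal_marginal:
  fixes p :: "('n \<Rightarrow> 'o) pmf"
  assumes "A \<subseteq> B"
  shows "marginal A (marginal B p) = marginal A p"
proof -
  have "restrict (restrict \<omega> B) A = restrict \<omega> A" for \<omega> :: "'n \<Rightarrow> 'o"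
    using assms by (auto simp: restrict_def fun_eq_iff)
  then show ?thesis by (simp add: marginal_def pmf.map_comp comp_def)
qed

lemma pmf_marginal:
  "pmf (marginal A p) g = (if g \<in> extensional A then measure_pmf.prob p (event A g) else 0)"
proof -
  have "(\<lambda>\<omega>. restrict \<omega> A) -` {g} = (if g \<in> extensional A then event A g else {})"
    by (auto simp: event_def extensional_def restrict_def fun_eq_iff)
  then show ?thesis by (simp add: marginal_def pmf_map)
qed

lemma marginal_cond_pmf_indep:
  assumes indep: "cond_indep p A B {}" and pos: "measure_pmf.prob p (event A v) > 0"
    and disj: "A \<inter> B = {}"
  shows "marginal B (cond_pmf p (event A v)) = marginal B p"
proof (rule pmf_eqI)
  fix g
  have A: "set_pmf p \<inter> event A v \<noteq> {}" using pos by (simp add: prob_pos_iff)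
  \<comment> \<open>\<open>cond_indep\<close> takes the values on \<open>A\<close> and
    \<open>B\<close> from one assignment, so \<open>v\<close> on \<open>A\<close> is glued to
    \<open>g\<close> elsewhere.\<close>
  define h where "h = (\<lambda>n. if n \<in> A then v n else g n)"
  have h: "event A h = event A v" "event B h = event B g"
    using disj by (auto simp: event_def h_def)
  have "measure_pmf.prob p (event A v \<inter> event B g) =
      measure_pmf.prob p (event A v) * measure_pmf.prob p (event B g)"
    using indep[unfolded cond_indep_def, rule_format, of h] by (simp add: cond_pmf_UNIV h)
  moreover have "measure_pmf.prob (cond_pmf p (event A v)) (event B g) =
      measure_pmf.prob p (event A v \<inter> event B g) / measure_pmf.prob p (event A v)"
    by (rule prob_cond_pmf[OF A])
  ultimately show "pmf (marginal B (cond_pmf p (event A v))) g = pmf (marginal B p) g"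
    using pos by (simp add: pmf_marginal)
qed

text \<open>The event depends only on coordinates kept by the restriction; this lets conditioning on
  it commute with marginalisation.\<close>

lemma val_event_vimage_restrict:
  assumes "A \<subseteq> B"
  shows "(\<lambda>\<omega>. restrict \<omega> (Sys ` B)) -` val_event A s = val_event A s"
  using assms by (force simp: val_event_def)

lemma val_event_Un: "val_event (A \<union> B) s = val_event A s \<inter> val_event B s"
  by (auto simp: val_event_def)

text \<open>Edges leaving a \<open>Sys\<close> node end in \<open>Sys\<close> nodes outside
  \<open>R\<close>, since the intervention removes all other edges into \<open>R\<close>. The
  disjunct \<open>u = e\<close> covers the path of length zero, as \<open>e\<close> need not be a
  cause of itself.\<close>

lemma descendant_in_augmented_do_graph:
  assumes "(Sys e, n) \<in> (edges (augment {e} (do_graph R (embed G))))\<^sup>*"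
  shows "\<exists>u. n = Sys u \<and> (u = e \<or> u \<notin> R \<and> is_cause G e u)"
  using assms
proof (induction rule: rtrancl_induct)
  case base
  then show ?case by simp
next
  case (step m n)
  then obtain u where u: "m = Sys u" "u = e \<or> u \<notin> R \<and> is_cause G e u" by blast
  from step.hyps(2) obtain u' where u': "n = Sys u'" "(u, u') \<in> edges G" "u' \<notin> R"
    by (auto simp: u(1) augment_def do_graph_def embed_def)
  have "is_cause G e u'"
    using u(2) u'(2) by (auto simp: is_cause_def)
  then show ?case using u' by blast
qed

lemma d_separated_intervention_node:
  assumes e: "e \<notin> R" "e \<notin> V" and noncause: "\<forall>v\<in>V. \<not> is_cause G e v"
  shows "d_separated (augment {e} (do_graph R (embed G))) {Intv e} (Sys ` (R \<union> V)) {}"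
  unfolding d_separated_def
proof (intro allI impI)
  let ?H = "augment {e} (do_graph R (embed G))"
  fix vs ds
  assume "undirected_path ?H vs ds \<and> hd vs \<in> {Intv e} \<and> last vs \<in> Sys ` (R \<union> V)"
  then have len: "length vs = Suc (length ds)"
    and path: "\<And>i. i < length ds \<Longrightarrow> if ds ! i then (vs ! i, vs ! Suc i) \<in> edges ?H
        else (vs ! Suc i, vs ! i) \<in> edges ?H"
    and hd: "vs ! 0 = Intv e" and last: "vs ! length ds \<in> Sys ` (R \<union> V)"
    by (cases "vs = []"; auto simp: undirected_path_def hd_conv_nth last_conv_nth)+
  show "blocked ?H {} vs ds"
  proof (rule ccontr)
    assume "\<not> blocked ?H {} vs ds"
    \<comment> \<open>With nothing conditioned on, every collider blocks, so on an unblocked path a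
      forward edge is followed by a forward edge.\<close>
    have nocol: "ds ! Suc i" if "Suc i < length ds" "ds ! i" for i
    proof (rule ccontr)
      assume "\<not> ds ! Suc i"
      then have "blocked ?H {} vs ds"
        unfolding blocked_def using that by (intro exI[of _ i]) simp
      with \<open>\<not> blocked ?H {} vs ds\<close> show False ..
    qed
    have nonempty: "0 < length ds"
      using hd last by (cases ds) auto
    have "(b, Intv e) \<notin> edges ?H" for b
      using e by (auto simp: augment_def do_graph_def embed_def)
    then have "ds ! 0"
      using path[OF nonempty] hd by (auto split: if_splits)
    then have dir: "ds ! i" if "i < length ds" for i
      using that by (induction i) (auto intro: nocol)
    have "(Intv e, vs ! 1) \<in> edges ?H"
      using path[OF nonempty] dir[OF nonempty] hd by simp
    then have first: "vs ! 1 = Sys e"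
      using e by (auto simp: augment_def do_graph_def embed_def)
    \<comment> \<open>All edges now point forward; the count starts at position 1, as position 0 is
      \<open>Intv e\<close>.\<close>
    have "(Sys e, vs ! Suc i) \<in> (edges ?H)\<^sup>*" if "Suc i \<le> length ds" for i
      using that
    proof (induction i)
      case 0
      then show ?case using first by simp
    next
      case (Suc i)
      then have "(vs ! Suc i, vs ! Suc (Suc i)) \<in> edges ?H"
        using path[of "Suc i"] dir[of "Suc i"] by simp
      then show ?case using Suc by (auto intro: rtrancl_into_rtrancl)
    qed
    from this[of "length ds - 1"] have "(Sys e, vs ! length ds) \<in> (edges ?H)\<^sup>*"
      using nonempty by simp
    \<comment> \<open>The endpoint is neither \<open>e\<close>, nor in \<open>R\<close>, nor in
      \<open>V\<close>.\<close>
    from descendant_in_augmented_do_graph[OF this] last e noncause show False by auto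
  qed
qed

text \<open>The two sides are the idle and the do conditional of \<open>P_aug M R {e}\<close>;
  independence from \<open>I_e\<close> makes both equal to its unconditional marginal. The marginal
  is joint with \<open>R\<close> because values of \<open>R\<close> are conditioned on
  later.\<close>

lemma marginal_P_do_noncause:
  assumes M: "causal_model M"
    and sub: "R \<subseteq> variables M" "V \<subseteq> variables M" "e \<in> variables M"
    and e: "e \<notin> R" "e \<notin> V" "s e \<in> vals M e"
    and noncause: "\<forall>v\<in>V. \<not> is_cause (graph M) e v"
  shows "marginal (Sys ` (R \<union> V)) (P_do M R) =
         marginal (Sys ` (R \<union> V)) (cond_pmf (P_do M (insert e R)) (val_event {e} s))"
proof -
  let ?B = "Sys ` (R \<union> V)" and ?S = "Sys ` variables M"
  let ?A = "P_aug M R {e}" and ?Q = "P_do M (insert e R)"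
  let ?H = "augment {e} (do_graph R (embed (graph M)))"
  have "distribution_for (vals M) ?H ?A" and rules: "intervention_rules M R {e}"
    using M sub e unfolding causal_model_def by auto
  then have "compatible ?H ?A" by (simp add: distribution_for_def)
  moreover have "{Intv e} \<subseteq> observed ?H" "?B \<subseteq> observed ?H"
    using sub by (auto simp: augment_def do_graph_def embed_def)
  ultimately have indep: "cond_indep ?A {Intv e} ?B {}"
    using d_separated_intervention_node[OF e(1,2) noncause]
    unfolding compatible_def by blast
  have idle: "idle_event {e} = event {Intv e} (\<lambda>_. Idle)"
    and do: "do_event {e} s = event {Intv e} (\<lambda>_. Do (s e))"
    by (auto simp: idle_event_def do_event_def event_def)
  have idle_pos: "measure_pmf.prob ?A (idle_event {e}) > 0"
    and idle_eq: "marginal ?S (cond_pmf ?A (idle_event {e})) = marginal ?S (P_do M R)"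
    using rules by (auto simp: intervention_rules_def)
  have do_pos: "measure_pmf.prob ?A (do_event {e} s) > 0"
    and do_eq: "marginal ?S (cond_pmf ?A (do_event {e} s)) =
      marginal ?S (cond_pmf ?Q (val_event {e} s))"
    using rules e(3) by (auto simp: intervention_rules_def)
  have BS: "?B \<subseteq> ?S" using sub by auto
  have "marginal ?B (P_do M R) = marginal ?B (cond_pmf ?A (idle_event {e}))"
    using idle_eq marginal_marginal[OF BS] by metis
  also have "\<dots> = marginal ?B ?A"
    using idle_pos unfolding idle by (intro marginal_cond_pmf_indep[OF indep]) auto
  also have "\<dots> = marginal ?B (cond_pmf ?A (do_event {e} s))"
    using do_pos unfolding do by (intro marginal_cond_pmf_indep[OF indep, symmetric]) auto
  also have "\<dots> = marginal ?B (cond_pmf ?Q (val_event {e} s))"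
    using do_eq marginal_marginal[OF BS] by metis
  finally show ?thesis .
qed

text \<open>Equal joint marginals on \<open>R\<close>, \<open>Y\<close> and \<open>W\<close> give
  equal conditionals of \<open>Y\<close>. Positivity is transferred as well, because
  \<open>affects\<close> admits only assignments for which both conditionals are
  well-defined.\<close>

lemma conditional_P_do_noncause:
  assumes M: "causal_model M"
    and sub: "R \<subseteq> variables M" "Y \<subseteq> variables M" "W \<subseteq> variables M" "e \<in> variables M"
    and e: "e \<notin> R" "e \<notin> Y" "e \<notin> W" "s e \<in> vals M e"
    and noncause: "\<forall>v\<in>Y \<union> W. \<not> is_cause (graph M) e v"
    and pos: "measure_pmf.prob (P_do M (insert e R)) (val_event (insert e R \<union> W) s) > 0"
  shows "measure_pmf.prob (P_do M R) (val_event (R \<union> W) s) > 0"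
    and "marginal (Sys ` Y) (cond_pmf (P_do M R) (val_event (R \<union> W) s)) =
         marginal (Sys ` Y) (cond_pmf (P_do M (insert e R)) (val_event (insert e R \<union> W) s))"
proof -
  let ?B = "R \<union> (Y \<union> W)" and ?E = "val_event (R \<union> W) s"
  let ?N = "P_do M R" and ?Q = "P_do M (insert e R)"
  let ?Qe = "cond_pmf ?Q (val_event {e} s)"
  let ?r = "\<lambda>\<omega> :: 'a node \<Rightarrow> 'b outcome. restrict \<omega> (Sys ` ?B)"
  have eq: "marginal (Sys ` ?B) ?N = marginal (Sys ` ?B) ?Qe"
    using assms by (intro marginal_P_do_noncause) auto
  have vim: "?r -` ?E = ?E"
    by (rule val_event_vimage_restrict) auto
  \<comment> \<open>Conditioning proceeds in two stages, first on the value of \<open>e\<close>,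
    then on \<open>R\<close> and \<open>W\<close>.\<close>
  have split: "val_event (insert e R \<union> W) s = val_event {e} s \<inter> ?E"
    using val_event_Un[of "{e}" "R \<union> W" s] by simp
  have Q: "set_pmf ?Q \<inter> (val_event {e} s \<inter> ?E) \<noteq> {}"
    using pos unfolding split by (simp add: prob_pos_iff)
  have Qe: "set_pmf ?Qe \<inter> ?E \<noteq> {}"
    using Q by (subst set_cond_pmf) auto
  have prob: "measure_pmf.prob (marginal (Sys ` ?B) p) ?E = measure_pmf.prob p ?E" for p
    by (simp add: marginal_def vim)
  have "measure_pmf.prob ?N ?E = measure_pmf.prob ?Qe ?E"
    using eq prob by metis
  with Qe show pos': "measure_pmf.prob ?N ?E > 0"
    by (simp only: prob_pos_iff[symmetric])
  have cond: "marginal (Sys ` ?B) (cond_pmf p ?E) = cond_pmf (marginal (Sys ` ?B) p) ?E"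
    if "set_pmf p \<inter> ?E \<noteq> {}" for p
    unfolding marginal_def using that by (subst cond_map_pmf) (simp_all only: vim not_False_eq_True)
  have "marginal (Sys ` ?B) (cond_pmf ?N ?E) = marginal (Sys ` ?B) (cond_pmf ?Qe ?E)"
    using cond[of ?N] cond[OF Qe] pos' eq by (simp add: prob_pos_iff)
  moreover have "marginal (Sys ` Y) (marginal (Sys ` ?B) p) = marginal (Sys ` Y) p"
    for p :: "('a node \<Rightarrow> 'b outcome) pmf"
    by (rule marginal_marginal) auto
  ultimately have "marginal (Sys ` Y) (cond_pmf ?N ?E) = marginal (Sys ` Y) (cond_pmf ?Qe ?E)"
    by metis
  then show "marginal (Sys ` Y) (cond_pmf ?N ?E) =
      marginal (Sys ` Y) (cond_pmf ?Q (val_event (insert e R \<union> W) s))"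
    unfolding split cond_pmf_cond_pmf[OF Q] .
qed

lemma affects_remove_noncause:
  assumes M: "causal_model M"
    and sub: "X \<subseteq> variables M" "Y \<subseteq> variables M" "Z \<subseteq> variables M" "W \<subseteq> variables M"
    and disj: "X \<inter> Z = {}" "Y \<inter> Z = {}" "Z \<inter> W = {}"
    and e: "e \<in> Z" and noncause: "\<forall>v\<in>Y \<union> W. \<not> is_cause (graph M) e v"
    and aff: "affects M X Y Z W"
  shows "affects M X Y (Z - {e}) W"
proof -
  let ?Z = "Z - {e}"
  from aff obtain s where s: "\<forall>e \<in> X \<union> Z \<union> W. s e \<in> vals M e"
    and p1: "measure_pmf.prob (P_do M (X \<union> Z)) (val_event (X \<union> Z \<union> W) s) > 0"
    and p2: "measure_pmf.prob (P_do M Z) (val_event (Z \<union> W) s) > 0"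
    and ne: "marginal (Sys ` Y) (cond_pmf (P_do M (X \<union> Z)) (val_event (X \<union> Z \<union> W) s)) \<noteq>
        marginal (Sys ` Y) (cond_pmf (P_do M Z) (val_event (Z \<union> W) s))"
    unfolding affects_def by blast
  have Z: "insert e ?Z = Z" and XZ: "insert e (X \<union> ?Z) = X \<union> Z" using e by auto
  have mem: "e \<in> variables M" "e \<notin> X \<union> ?Z" "e \<notin> ?Z" "e \<notin> Y" "e \<notin> W" "s e \<in> vals M e"
    "X \<union> ?Z \<subseteq> variables M" "?Z \<subseteq> variables M"
    using e sub disj s by auto
  \<comment> \<open>Both sides of the relation lose \<open>e\<close> under the same assignment
    \<open>s\<close>, which therefore also witnesses the smaller relation.\<close>
  note XZ_cond = conditional_P_do_noncause[where R = "X \<union> ?Z" and e = e and s = s, unfolded XZ,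
      OF M mem(7) sub(2,4) mem(1,2,4,5,6) noncause p1]
  note Z_cond = conditional_P_do_noncause[where R = ?Z and e = e and s = s, unfolded Z,
      OF M mem(8) sub(2,4) mem(1,3,4,5,6) noncause p2]
  have "\<forall>e \<in> X \<union> ?Z \<union> W. s e \<in> vals M e" using s by blast
  then show ?thesis
    unfolding affects_def using XZ_cond Z_cond ne by metis
qed

theorem corollary2p37:
  fixes M :: "('v, 'a) model" and X Y Z W :: "'v set"
  assumes "causal_model M"
    and "X \<subseteq> variables M" and "Y \<subseteq> variables M" and "Z \<subseteq> variables M" and "W \<subseteq> variables M"
    and "X \<inter> Y = {}" and "X \<inter> Z = {}" and "X \<inter> W = {}"
    and "Y \<inter> Z = {}" and "Y \<inter> W = {}" and "Z \<inter> W = {}"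
    and "X \<noteq> {}" and "Y \<noteq> {}"
  shows "(indecreasable M X Y Z {} \<longrightarrow>
            (\<forall>e\<^sub>Z\<in>Z. \<exists>e\<^sub>Y\<in>Y. is_cause (graph M) e\<^sub>Z e\<^sub>Y)) \<and>
         (indecreasable M X Y Z W \<longrightarrow>
            (\<forall>e\<^sub>Z\<in>Z. \<exists>e\<^sub>Y\<^sub>W \<in> Y \<union> W. is_cause (graph M) e\<^sub>Z e\<^sub>Y\<^sub>W))"
proof -
  have "\<exists>v \<in> Y \<union> V. is_cause (graph M) e v"
    if "indecreasable M X Y Z V" "e \<in> Z" "V \<subseteq> variables M" "Z \<inter> V = {}" for V e
    using affects_remove_noncause[of M X Y Z V e] that assms(1-4,7,9)
    unfolding indecreasable_def by blast
  \<comment> \<open>The first claim is the case of an empty conditioning set.\<close>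
  from this[of "{}"] this[of W] show ?thesis
    using assms(5,11) by simp
qed

end
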